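(* For every integer $d>2$, the mother group $G_d$, equipped with the word length metric of a finite symmetric generating set, has infinite asymptotic dimension: $\operatorname{asdim} G_d=\infty$.
   Context: Rooted trees. Let $d\ge 2$, let $X=\{1,\dots,d\}$, and let $X^*$ be the set of finite words over $X$ (including the empty word $\emptyset$), viewed as the vertex set of the $d$-regular rooted tree $T_d$ with root $\emptyset$, where $w$ and $wx$ are joined by an edge for $w\in X^*$, $x\in X$. $\mathrm{Aut}(T_d)=\mathrm{Aut}(X^* )$ is the group of bijections of $X^*$ preserving the root and adjacency. For $g\in\mathrm{Aut}(X^* )$ and $v\in X^*$, the restriction $g|_v\in\mathrm{Aut}(X^* )$ is defined by $g(vw)=g(v)\,g|_v(w)$ for all $w\in X^*$. One writes $g=(g|_1,\dots,g|_d)\sigma$, where $\sigma\in S_d$ is the action of $g$ on the first level $X$; this identifies $\mathrm{Aut}(X^* )$ with the wreath product $\mathrm{Aut}(X^* )\wr d$. Here, for a group $G$, $G\wr d=G^d\rtimes S_d$ has multiplication $((g_1,\dots,g_d),\sigma)((h_1,\dots,h_d),\tau)=((g_1h_{\sigma(1)},\dots,g_dh_{\sigma(d)}),\sigma\tau)$; products of permutations and of automorphisms are read from left to right ($gh$ means first $g$, then $h$). Mother group $G_d$. Each $a\in S_d$ is regarded as the automorphism $a=(1,\dots,1)a$ of $T_d$. Let $B_d=S_d\wr(d-1)=S_d^{d-1}\rtimes S_{d-1}$; each $b=(b_1,\dots,b_{d-1})\sigma\in B_d$ (with $b_i\in S_d$, $\sigma\in S_{d-1}$ acting on $\{1,\dots,d-1\}$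 and extended to fix $d$) is regarded as the automorphism of $T_d$ defined recursively by $b=(b_1,\dots,b_{d-1},b)\sigma$. $G_d$ is the subgroup of $\mathrm{Aut}(T_d)$ generated by the (finite) images of $S_d$ and $B_d$. Metric. For a group $G$ with finite symmetric generating set $\Sigma$, $l(g)$ is the least length of a word in $\Sigma$ representing $g$, and $d(g,h)=l(gh^{-1})$. Asymptotic dimension. A family of subsets of a metric space is $r$-disjoint if any two distinct members $U,U'$ satisfy $\inf\{d(x,x'):x\in U,x'\in U'\}>r$. A metric space $Y$ satisfies $\operatorname{asdim}Y\le n$ if for every $r>0$ one can write $Y=\bigcup_{i=0}^n Y_i$ where each $Y_i$ is the union of an $r$-disjoint family $\{Y_{ij}\}_j$ with $\sup_{i,j}\operatorname{diam}Y_{ij}<\infty$. $\operatorname{asdim}Y=\infty$ means $\operatorname{asdim}Y\le n$ holds for no $n$. *)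

theory Defs
  imports "HOL-Algebra.Algebra" "HOL-Library.Extended_Real" "HOL-Combinatorics.Permutations"
begin

definition tree_words :: "nat \<Rightarrow> nat list set" where
  "tree_words d = lists {1..d}"

definition tree_adj :: "nat \<Rightarrow> nat list \<Rightarrow> nat list \<Rightarrow> bool" where
  "tree_adj d u v \<longleftrightarrow>
     (\<exists>w\<in>tree_words d. \<exists>x\<in>{1..d}. (u = w \<and> v = w @ [x]) \<or> (u = w @ [x] \<and> v = w))"

text \<open>Automorphisms are kept extensional outside the tree, so that equality of functions
  is equality of automorphisms.\<close>

definition tree_auts :: "nat \<Rightarrow> (nat list \<Rightarrow> nat list) set" where
  "tree_auts d = {g \<in> extensional (tree_words d).
     bij_betw g (tree_words d) (tree_words d) \<and> g [] = [] \<and>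
     (\<forall>u\<in>tree_words d. \<forall>v\<in>tree_words d. tree_adj d u v \<longleftrightarrow> tree_adj d (g u) (g v))}"

text \<open>Products are read from left to right: the product of g and h is first g, then h.\<close>

definition Aut_tree :: "nat \<Rightarrow> (nat list \<Rightarrow> nat list) monoid" where
  "Aut_tree d = \<lparr>carrier = tree_auts d,
                 monoid.mult = (\<lambda>g h. compose (tree_words d) h g),
                 one = (\<lambda>w\<in>tree_words d. w)\<rparr>"

text \<open>The automorphism \<open>(g 1, \<dots>, g d) \<sigma>\<close> in wreath notation.\<close>

definition wreath_aut ::
    "nat \<Rightarrow> (nat \<Rightarrow> nat list \<Rightarrow> nat list) \<Rightarrow> (nat \<Rightarrow> nat) \<Rightarrow> nat list \<Rightarrow> nat list" where
  "wreath_aut d g \<sigma> = (\<lambda>w\<in>tree_words d. case w of [] \<Rightarrow> [] | x # u \<Rightarrow> \<sigma> x # g x u)"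

definition rooted_aut :: "nat \<Rightarrow> (nat \<Rightarrow> nat) \<Rightarrow> nat list \<Rightarrow> nat list" where
  "rooted_aut d a = wreath_aut d (\<lambda>_. \<one>\<^bsub>Aut_tree d\<^esub>) a"

text \<open>The solution of \<open>b = (b 1, \<dots>, b (d - 1), b) \<sigma>\<close>;
  see \<open>directed_aut_wreath\<close> and \<open>directed_aut_unique\<close> below.\<close>

primrec directed_fun ::
    "nat \<Rightarrow> (nat \<Rightarrow> nat \<Rightarrow> nat) \<Rightarrow> (nat \<Rightarrow> nat) \<Rightarrow> nat list \<Rightarrow> nat list" where
  "directed_fun d b \<sigma> [] = []"
| "directed_fun d b \<sigma> (x # u) =
     \<sigma> x # (if x = d then directed_fun d b \<sigma> u else rooted_aut d (b x) u)"

definition directed_aut ::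
    "nat \<Rightarrow> (nat \<Rightarrow> nat \<Rightarrow> nat) \<Rightarrow> (nat \<Rightarrow> nat) \<Rightarrow> nat list \<Rightarrow> nat list" where
  "directed_aut d b \<sigma> = restrict (directed_fun d b \<sigma>) (tree_words d)"

definition rooted_gens :: "nat \<Rightarrow> (nat list \<Rightarrow> nat list) set" where
  "rooted_gens d = {rooted_aut d a | a. a permutes {1..d}}"

definition directed_gens :: "nat \<Rightarrow> (nat list \<Rightarrow> nat list) set" where
  "directed_gens d = {directed_aut d b \<sigma> | b \<sigma>.
     (\<forall>i\<in>{1..d-1}. b i permutes {1..d}) \<and> \<sigma> permutes {1..d-1}}"

definition mother_group :: "nat \<Rightarrow> (nat list \<Rightarrow> nat list) monoid" where
  "mother_group d = subgroup_generated (Aut_tree d) (rooted_gens d \<union> directed_gens d)"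

definition finite_symmetric_gen_set :: "('a, 'b) monoid_scheme \<Rightarrow> 'a set \<Rightarrow> bool" where
  "finite_symmetric_gen_set G S \<longleftrightarrow>
     finite S \<and> S \<subseteq> carrier G \<and> (\<forall>s\<in>S. inv\<^bsub>G\<^esub> s \<in> S) \<and> generate G S = carrier G"

definition word_length :: "('a, 'b) monoid_scheme \<Rightarrow> 'a set \<Rightarrow> 'a \<Rightarrow> nat" where
  "word_length G S g =
     (LEAST n. \<exists>ws\<in>lists S. length ws = n \<and> foldr (monoid.mult G) ws \<one>\<^bsub>G\<^esub> = g)"

definition word_dist :: "('a, 'b) monoid_scheme \<Rightarrow> 'a set \<Rightarrow> 'a \<Rightarrow> 'a \<Rightarrow> real" where
  "word_dist G S g h = real (word_length G S (g \<otimes>\<^bsub>G\<^esub> inv\<^bsub>G\<^esub> h))"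

text \<open>Infima and suprema of distances are taken in the extended reals, so that the distance
  to the empty set is infinite and unbounded sets have infinite diameter.\<close>

definition r_disjoint :: "('a \<Rightarrow> 'a \<Rightarrow> real) \<Rightarrow> real \<Rightarrow> 'a set set \<Rightarrow> bool" where
  "r_disjoint dst r \<U> \<longleftrightarrow>
     (\<forall>U\<in>\<U>. \<forall>V\<in>\<U>. U \<noteq> V \<longrightarrow> (INF x\<in>U. INF y\<in>V. ereal (dst x y)) > ereal r)"

definition ediam :: "('a \<Rightarrow> 'a \<Rightarrow> real) \<Rightarrow> 'a set \<Rightarrow> ereal" where
  "ediam dst U = (SUP x\<in>U. SUP y\<in>U. ereal (dst x y))"

definition asdim_le :: "'a set \<Rightarrow> ('a \<Rightarrow> 'a \<Rightarrow> real) \<Rightarrow> nat \<Rightarrow> bool" where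
  "asdim_le M dst n \<longleftrightarrow>
     (\<forall>r>0. \<exists>\<U> :: nat \<Rightarrow> 'a set set.
        M = (\<Union>i\<le>n. \<Union>(\<U> i)) \<and>
        (\<forall>i\<le>n. r_disjoint dst r (\<U> i)) \<and>
        (SUP i\<in>{..n}. SUP U\<in>\<U> i. ediam dst U) < \<infinity>)"

definition asdim :: "'a set \<Rightarrow> ('a \<Rightarrow> 'a \<Rightarrow> real) \<Rightarrow> enat" where
  "asdim M dst = (INF n\<in>{n. asdim_le M dst n}. enat n)"

lemma asdim_infinite_iff: "asdim M dst = \<infinity> \<longleftrightarrow> (\<forall>n. \<not> asdim_le M dst n)"
proof
  assume A: "asdim M dst = \<infinity>"
  show "\<forall>n. \<not> asdim_le M dst n"
  proof (intro allI notI)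
    fix n assume "asdim_le M dst n"
    then have "asdim M dst \<le> enat n"
      unfolding asdim_def by (intro INF_lower) simp
    with A show False by simp
  qed
qed (simp add: asdim_def top_enat_def)

lemma Nil_tree_words [simp]: "[] \<in> tree_words d"
  by (simp add: tree_words_def)

lemma Cons_tree_words [simp]: "x # u \<in> tree_words d \<longleftrightarrow> 1 \<le> x \<and> x \<le> d \<and> u \<in> tree_words d"
  by (auto simp: tree_words_def)

lemma append_tree_words [simp]:
  "u @ v \<in> tree_words d \<longleftrightarrow> u \<in> tree_words d \<and> v \<in> tree_words d"
  by (auto simp: tree_words_def)

lemma tree_auts_closed: "g \<in> tree_auts d \<Longrightarrow> w \<in> tree_words d \<Longrightarrow> g w \<in> tree_words d"
  by (auto simp: tree_auts_def dest: bij_betwE)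

lemma Aut_tree_simps:
  "carrier (Aut_tree d) = tree_auts d"
  "g \<otimes>\<^bsub>Aut_tree d\<^esub> h = compose (tree_words d) h g"
  "\<one>\<^bsub>Aut_tree d\<^esub> = (\<lambda>w\<in>tree_words d. w)"
  by (auto simp: Aut_tree_def)

lemma tree_auts_adj:
  "g \<in> tree_auts d \<Longrightarrow> u \<in> tree_words d \<Longrightarrow> v \<in> tree_words d \<Longrightarrow>
     tree_adj d (g u) (g v) \<longleftrightarrow> tree_adj d u v"
  by (simp add: tree_auts_def)

lemma tree_auts_compose:
  assumes "g \<in> tree_auts d" "h \<in> tree_auts d"
  shows "compose (tree_words d) h g \<in> tree_auts d"
proof -
  have "bij_betw (compose (tree_words d) h g) (tree_words d) (tree_words d)"
    using assms by (auto simp: tree_auts_def intro: bij_betw_compose)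
  moreover have "tree_adj d (h (g u)) (h (g v)) \<longleftrightarrow> tree_adj d u v"
    if "u \<in> tree_words d" "v \<in> tree_words d" for u v
    using that assms by (simp add: tree_auts_adj tree_auts_closed)
  moreover have "g [] = []" "h [] = []" using assms by (auto simp: tree_auts_def)
  ultimately show ?thesis
    unfolding tree_auts_def by (simp add: compose_def)
qed

lemma tree_auts_inverse:
  assumes g: "g \<in> tree_auts d"
  defines "h \<equiv> restrict (inv_into (tree_words d) g) (tree_words d)"
  shows "h \<in> tree_auts d" "compose (tree_words d) g h = (\<lambda>w\<in>tree_words d. w)"
proof -
  let ?W = "tree_words d"
  have bij: "bij_betw g ?W ?W" and g0: "g [] = []"
    using g by (auto simp: tree_auts_def)
  have hg: "h (g u) = u" if "u \<in> ?W" for u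
    using that bij tree_auts_closed[OF g that] by (simp add: h_def bij_betw_inv_into_left)
  have gh: "g (h u) = u" if "u \<in> ?W" for u
    using that bij by (simp add: h_def bij_betw_inv_into_right)
  have hW: "h u \<in> ?W" if "u \<in> ?W" for u
    using that bij by (metis hg bij_betw_def imageE)
  have "bij_betw h ?W ?W"
    by (rule bij_betw_byWitness[of _ g]) (use hg gh hW tree_auts_closed[OF g] in auto)
  moreover have "h [] = []" using hg[of "[]"] g0 by simp
  moreover have "tree_adj d u v \<longleftrightarrow> tree_adj d (h u) (h v)" if "u \<in> ?W" "v \<in> ?W" for u v
    using tree_auts_adj[OF g hW[OF that(1)] hW[OF that(2)]] gh[OF that(1)] gh[OF that(2)] by simp
  ultimately show "h \<in> tree_auts d"
    by (auto simp: tree_auts_def h_def)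
  show "compose ?W g h = (\<lambda>w\<in>?W. w)"
    using gh by (auto simp: compose_def)
qed

lemma group_Aut_tree: "group (Aut_tree d)"
proof (rule groupI)
  fix g assume "g \<in> carrier (Aut_tree d)"
  then show "\<exists>h\<in>carrier (Aut_tree d). h \<otimes>\<^bsub>Aut_tree d\<^esub> g = \<one>\<^bsub>Aut_tree d\<^esub>"
    using tree_auts_inverse[of g d] unfolding Aut_tree_simps by metis
next
  fix f g h assume "f \<in> carrier (Aut_tree d)" "g \<in> carrier (Aut_tree d)" "h \<in> carrier (Aut_tree d)"
  then show "f \<otimes>\<^bsub>Aut_tree d\<^esub> g \<otimes>\<^bsub>Aut_tree d\<^esub> h = f \<otimes>\<^bsub>Aut_tree d\<^esub> (g \<otimes>\<^bsub>Aut_tree d\<^esub> h)"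
    by (auto simp: Aut_tree_simps compose_def tree_auts_closed)
next
  have "bij_betw (\<lambda>w\<in>tree_words d. w) (tree_words d) (tree_words d)"
    by (auto simp: bij_betw_def inj_on_def)
  then show "\<one>\<^bsub>Aut_tree d\<^esub> \<in> carrier (Aut_tree d)"
    by (auto simp: Aut_tree_simps tree_auts_def)
next
  fix g assume "g \<in> carrier (Aut_tree d)"
  then show "\<one>\<^bsub>Aut_tree d\<^esub> \<otimes>\<^bsub>Aut_tree d\<^esub> g = g"
    by (auto simp: Aut_tree_simps tree_auts_def compose_def extensional_def)
qed (auto simp: Aut_tree_simps intro: tree_auts_compose)

lemma tree_autsI:
  assumes "\<And>w x. w \<in> tree_words d \<Longrightarrow> x \<in> {1..d} \<Longrightarrow> \<exists>y\<in>{1..d}. g (w @ [x]) = g w @ [y]"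
    and "\<And>w x. w \<in> tree_words d \<Longrightarrow> x \<in> {1..d} \<Longrightarrow> \<exists>y\<in>{1..d}. h (w @ [x]) = h w @ [y]"
    and "g [] = []" "h [] = []" "g \<in> extensional (tree_words d)"
    and "\<And>w. w \<in> tree_words d \<Longrightarrow> h (g w) = w" "\<And>w. w \<in> tree_words d \<Longrightarrow> g (h w) = w"
  shows "g \<in> tree_auts d"
proof -
  let ?W = "tree_words d"
  have gW: "g w \<in> ?W" if "w \<in> ?W" for w
    using that
  proof (induction w rule: rev_induct)
    case (snoc x w)
    then show ?case using assms(1)[of w x] by auto
  qed (simp add: assms)
  have hW: "h w \<in> ?W" if "w \<in> ?W" for w
    using that
  proof (induction w rule: rev_induct)
    case (snoc x w)
    then show ?case using assms(2)[of w x] by auto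
  qed (simp add: assms)
  have "bij_betw g ?W ?W"
    by (rule bij_betw_byWitness[of _ h]) (use assms gW hW in auto)
  moreover have "tree_adj d (g u) (g v)" if "tree_adj d u v" for u v
    using that assms(1) gW unfolding tree_adj_def by metis
  moreover have "tree_adj d (h u) (h v)" if "tree_adj d u v" for u v
    using that assms(2) hW unfolding tree_adj_def by metis
  ultimately show ?thesis
    using assms(3,5,6) unfolding tree_auts_def by (auto, metis)
qed

lemma rooted_aut_simps [simp]:
  "rooted_aut d a [] = []"
  "x # u \<in> tree_words d \<Longrightarrow> rooted_aut d a (x # u) = a x # u"
  by (auto simp: rooted_aut_def wreath_aut_def Aut_tree_simps)

lemma permutes_range: "a permutes {1..d} \<Longrightarrow> 1 \<le> x \<Longrightarrow> x \<le> d \<Longrightarrow> 1 \<le> a x \<and> a x \<le> (d::nat)"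
  using permutes_in_image[of a "{1..d}" x] by auto

lemma rooted_aut_closed:
  "a permutes {1..d} \<Longrightarrow> w \<in> tree_words d \<Longrightarrow> rooted_aut d a w \<in> tree_words d"
  using permutes_range[of a d] by (cases w) auto

lemma rooted_aut_mult:
  assumes "a permutes {1..d}"
  shows "rooted_aut d a \<otimes>\<^bsub>Aut_tree d\<^esub> rooted_aut d c = rooted_aut d (c \<circ> a)"
proof
  fix w
  show "(rooted_aut d a \<otimes>\<^bsub>Aut_tree d\<^esub> rooted_aut d c) w = rooted_aut d (c \<circ> a) w"
  proof (cases "w \<in> tree_words d")
    case True
    then show ?thesis
      using permutes_range[OF assms] by (cases w) (auto simp: Aut_tree_simps compose_def)
  qed (simp add: Aut_tree_simps compose_def rooted_aut_def wreath_aut_def)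
qed

lemma rooted_aut_id: "rooted_aut d id = \<one>\<^bsub>Aut_tree d\<^esub>"
proof
  fix w show "rooted_aut d id w = \<one>\<^bsub>Aut_tree d\<^esub> w"
    by (cases w) (auto simp: Aut_tree_simps rooted_aut_def wreath_aut_def)
qed

lemma rooted_aut_snoc:
  assumes "a permutes {1..d}" "w \<in> tree_words d" "x \<in> {1..d}"
  shows "\<exists>y\<in>{1..d}. rooted_aut d a (w @ [x]) = rooted_aut d a w @ [y]"
  using assms permutes_range[of a d x] by (cases w) auto

lemma rooted_aut_inverse:
  assumes "a permutes {1..d}" "w \<in> tree_words d"
  shows "rooted_aut d (inv_into UNIV a) (rooted_aut d a w) = w"
    and "rooted_aut d a (rooted_aut d (inv_into UNIV a) w) = w"
  using assms permutes_range[OF assms(1)] permutes_range[OF permutes_inv[OF assms(1)]]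
  by (cases w; auto simp: permutes_inverses)+

lemma rooted_aut_in_tree_auts:
  assumes "a permutes {1..d}"
  shows "rooted_aut d a \<in> tree_auts d"
proof (rule tree_autsI[where h = "rooted_aut d (inv_into UNIV a)"])
  show "rooted_aut d a \<in> extensional (tree_words d)"
    by (simp add: rooted_aut_def wreath_aut_def)
qed (fact rooted_aut_snoc[OF assms] rooted_aut_snoc[OF permutes_inv[OF assms]]
       rooted_aut_simps(1) rooted_aut_inverse[OF assms])+

lemma permutes_pred:
  fixes d :: nat assumes "s permutes {1..d-1}"
  shows "s d = d" "s permutes {1..d}" "s x = d \<longleftrightarrow> x = d"
proof -
  show *: "s d = d" by (rule permutes_not_in[OF assms]) auto
  show "s permutes {1..d}" by (rule permutes_subset[OF assms]) auto
  show "s x = d \<longleftrightarrow> x = d" using * permutes_inj[OF assms] by (metis injD)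
qed

abbreviation wreath_data :: "nat \<Rightarrow> (nat \<Rightarrow> nat \<Rightarrow> nat) \<Rightarrow> (nat \<Rightarrow> nat) \<Rightarrow> bool" where
  "wreath_data d b s \<equiv> (\<forall>i\<in>{1..d-1}. b i permutes {1..d}) \<and> s permutes {1..d-1}"

lemma wreath_data_range: "1 \<le> x \<Longrightarrow> x \<le> d \<Longrightarrow> x \<noteq> d \<Longrightarrow> x \<in> {1..d-1::nat}"
  by auto

lemma directed_fun_closed:
  assumes "wreath_data d b s" "w \<in> tree_words d"
  shows "directed_fun d b s w \<in> tree_words d"
  using assms(2)
proof (induction w)
  case (Cons x u)
  then show ?case
    using assms(1) permutes_range[OF permutes_pred(2), of s d x]
    by (auto intro!: rooted_aut_closed)
qed simp

lemma directed_fun_mult: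
  assumes "wreath_data d b s" "wreath_data d c t" "w \<in> tree_words d"
  shows "directed_fun d c t (directed_fun d b s w) = directed_fun d (\<lambda>i. c (s i) \<circ> b i) (t \<circ> s) w"
  using assms(3)
proof (induction w)
  case (Cons x u)
  have "rooted_aut d (c (s x)) (rooted_aut d (b x) u) = rooted_aut d (c (s x) \<circ> b x) u" if "x \<noteq> d"
    using rooted_aut_mult[of "b x" d "c (s x)"] wreath_data_range[of x d] that Cons.prems assms(1)
    by (auto simp: Aut_tree_simps compose_def fun_eq_iff dest!: spec[of _ u])
  then show ?case
    using Cons assms(1) permutes_pred[of s d] by (auto simp: comp_def)
qed simp

text \<open>The map from the wreath product of the two symmetric groups is multiplicative.\<close>

lemma directed_aut_mult:
  assumes "wreath_data d b s" "wreath_data d c t"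
  shows "directed_aut d b s \<otimes>\<^bsub>Aut_tree d\<^esub> directed_aut d c t =
         directed_aut d (\<lambda>i. c (s i) \<circ> b i) (t \<circ> s)"
  using directed_fun_mult[OF assms] directed_fun_closed[OF assms(1)]
  by (auto simp: Aut_tree_simps compose_def directed_aut_def restrict_def fun_eq_iff)

lemma directed_fun_snoc:
  assumes "wreath_data d b s" "w \<in> tree_words d" "x \<in> {1..d}"
  shows "\<exists>y\<in>{1..d}. directed_fun d b s (w @ [x]) = directed_fun d b s w @ [y]"
  using assms(2)
proof (induction w)
  case Nil
  then show ?case using assms permutes_range[OF permutes_pred(2), of s d x] by auto
next
  case (Cons z u)
  show ?case
  proof (cases "z = d")
    case False
    then have "b z permutes {1..d}" using assms(1) Cons.prems wreath_data_range[of z d] by auto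
    from rooted_aut_snoc[OF this, of u x] show ?thesis using False Cons.prems assms(3) by auto
  qed (use Cons in auto)
qed

lemma directed_fun_id:
  assumes "\<And>i. i \<in> {1..d-1} \<Longrightarrow> b i = id" "w \<in> tree_words d"
  shows "directed_fun d b id w = w"
  using assms(2)
proof (induction w)
  case (Cons x u)
  then show ?case
    using assms(1)[of x] by (auto simp: rooted_aut_id Aut_tree_simps)
qed simp

lemma directed_fun_cong:
  assumes "\<And>i. i \<in> {1..d-1} \<Longrightarrow> b i = c i" "w \<in> tree_words d"
  shows "directed_fun d b s w = directed_fun d c s w"
  using assms(2)
proof (induction w)
  case (Cons x u)
  then show ?case using assms(1)[of x] by auto
qed simp

lemma wreath_data_inv:
  assumes "wreath_data d b s"
  shows "wreath_data d (\<lambda>i. inv_into UNIV (b (inv_into UNIV s i))) (inv_into UNIV s)"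
proof -
  have "inv_into UNIV s permutes {1..d-1}" using assms permutes_inv by blast
  then show ?thesis
    using assms permutes_in_image[of "inv_into UNIV s" "{1..d-1}"] by (auto intro!: permutes_inv)
qed

lemma directed_fun_inverse:
  assumes "wreath_data d b s" "w \<in> tree_words d"
  defines "b' \<equiv> \<lambda>i. inv_into UNIV (b (inv_into UNIV s i))"
  shows "directed_fun d b' (inv_into UNIV s) (directed_fun d b s w) = w"
    and "directed_fun d b s (directed_fun d b' (inv_into UNIV s) w) = w"
proof -
  have w': "wreath_data d b' (inv_into UNIV s)"
    unfolding b'_def by (rule wreath_data_inv[OF assms(1)])
  have s: "s permutes {1..d-1}" and s': "inv_into UNIV s permutes {1..d-1}"
    using assms(1) permutes_inv by auto
  have b: "b i permutes {1..d}" if "i \<in> {1..d-1}" for i using assms(1) that by blast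
  show "directed_fun d b' (inv_into UNIV s) (directed_fun d b s w) = w"
    unfolding directed_fun_mult[OF assms(1) w' assms(2)] permutes_inv_o(2)[OF s]
    by (rule directed_fun_id[OF _ assms(2)])
       (auto simp: b'_def permutes_inverses[OF s] intro!: permutes_inv_o b)
  show "directed_fun d b s (directed_fun d b' (inv_into UNIV s) w) = w"
    unfolding directed_fun_mult[OF w' assms(1,2)] permutes_inv_o(1)[OF s]
  proof (rule directed_fun_id[OF _ assms(2)])
    fix i assume "i \<in> {1..d-1}"
    then have "inv_into UNIV s i \<in> {1..d-1}" using permutes_in_image[OF s'] by blast
    from permutes_inv_o(1)[OF b[OF this]] show "b (inv_into UNIV s i) \<circ> b' i = id"
      by (simp add: b'_def)
  qed
qed

lemma directed_aut_in_tree_auts: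
  assumes "wreath_data d b s"
  shows "directed_aut d b s \<in> tree_auts d"
  by (rule tree_autsI[where h = "directed_aut d (\<lambda>i. inv_into UNIV (b (inv_into UNIV s i))) (inv_into UNIV s)"])
     (use directed_fun_snoc[OF assms] directed_fun_snoc[OF wreath_data_inv[OF assms]]
          directed_fun_inverse[OF assms] directed_fun_closed[OF assms]
          directed_fun_closed[OF wreath_data_inv[OF assms]]
      in \<open>auto simp: directed_aut_def\<close>)

lemma directed_aut_wreath:
  "directed_aut d b s =
     wreath_aut d (\<lambda>i. if i = d then directed_aut d b s else rooted_aut d (b i)) s"
proof
  fix w
  show "directed_aut d b s w =
     wreath_aut d (\<lambda>i. if i = d then directed_aut d b s else rooted_aut d (b i)) s w"
    by (cases w) (auto simp: directed_aut_def wreath_aut_def)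
qed

lemma directed_aut_unique:
  assumes "g = wreath_aut d (\<lambda>i. if i = d then g else rooted_aut d (b i)) s"
  shows "g = directed_aut d b s"
proof
  fix w
  have g: "g v = wreath_aut d (\<lambda>i. if i = d then g else rooted_aut d (b i)) s v" for v
    using assms by metis
  have "g w = directed_fun d b s w" if "w \<in> tree_words d"
    using that
  proof (induction w)
    case Nil
    then show ?case by (subst g) (simp add: wreath_aut_def)
  next
    case (Cons x u)
    then show ?case by (subst g) (simp add: wreath_aut_def)
  qed
  moreover have "g w = undefined" if "w \<notin> tree_words d"
    by (subst g) (simp add: that wreath_aut_def)
  ultimately show "g w = directed_aut d b s w"
    by (simp add: directed_aut_def)
qed

lemma mother_gens_subset: "rooted_gens d \<union> directed_gens d \<subseteq> carrier (Aut_tree d)"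
  by (auto simp: rooted_gens_def directed_gens_def Aut_tree_simps
      intro: rooted_aut_in_tree_auts directed_aut_in_tree_auts)

lemma group_mother_group: "group (mother_group d)"
  unfolding mother_group_def by (rule group.group_subgroup_generated[OF group_Aut_tree])

lemma finite_mother_gens: "finite (rooted_gens d \<union> directed_gens d)"
proof -
  have "rooted_gens d = rooted_aut d ` {a. a permutes {1..d}}"
    by (auto simp: rooted_gens_def)
  then have 1: "finite (rooted_gens d)" by (simp add: finite_permutations)
  let ?F = "{1..d-1} \<rightarrow>\<^sub>E {a. a permutes {1..d}}"
  have "directed_gens d \<subseteq> (\<lambda>(b, s). directed_aut d b s) ` (?F \<times> {s. s permutes {1..d-1}})"
  proof
    fix g assume "g \<in> directed_gens d"
    then obtain b s where g: "g = directed_aut d b s" "wreath_data d b s"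
      by (auto simp: directed_gens_def)
    have "directed_aut d b s = directed_aut d (restrict b {1..d-1}) s"
      using directed_fun_cong[of d b "restrict b {1..d-1}"]
      by (auto simp: directed_aut_def restrict_def fun_eq_iff)
    then show "g \<in> (\<lambda>(b, s). directed_aut d b s) ` (?F \<times> {s. s permutes {1..d-1}})"
      using g by (intro image_eqI[where x = "(restrict b {1..d-1}, s)"]) auto
  qed
  moreover have "finite (?F \<times> {s. s permutes {1..d-1}})"
    by (intro finite_cartesian_product finite_PiE) (auto simp: finite_permutations)
  ultimately have "finite (directed_gens d)" by (meson finite_imageI finite_subset)
  with 1 show ?thesis by simp
qed

lemma mother_gens_generating:
  "finite_symmetric_gen_set (mother_group d) (rooted_gens d \<union> directed_gens d)"
proof -
  let ?A = "Aut_tree d" and ?S = "rooted_gens d \<union> directed_gens d"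
  interpret A: group ?A by (rule group_Aut_tree)
  have sub: "?S \<subseteq> carrier (mother_group d)"
    unfolding mother_group_def using A.subgroup_generated_subset_carrier_subset[OF mother_gens_subset] .
  have "inv\<^bsub>?A\<^esub> g \<in> ?S" if "g \<in> ?S" for g
    using that
  proof
    assume "g \<in> rooted_gens d"
    then obtain a where a: "g = rooted_aut d a" "a permutes {1..d}"
      by (auto simp: rooted_gens_def)
    have a': "inv_into UNIV a permutes {1..d}" using a permutes_inv by blast
    have "inv\<^bsub>?A\<^esub> g = rooted_aut d (inv_into UNIV a)"
      using a a' rooted_aut_in_tree_auts rooted_aut_mult[OF a', of a]
      by (intro A.inv_equality) (auto simp: Aut_tree_simps(1) permutes_inv_o rooted_aut_id)
    then show ?thesis using a' by (auto simp: rooted_gens_def)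
  next
    assume "g \<in> directed_gens d"
    then obtain b s where g: "g = directed_aut d b s" "wreath_data d b s"
      by (auto simp: directed_gens_def)
    define c where "c = (\<lambda>i. inv_into UNIV (b (inv_into UNIV s i)))"
    have c: "wreath_data d c (inv_into UNIV s)"
      unfolding c_def by (rule wreath_data_inv[OF g(2)])
    have "directed_aut d c (inv_into UNIV s) \<otimes>\<^bsub>?A\<^esub> g = \<one>\<^bsub>?A\<^esub>"
      using directed_fun_inverse(2)[OF g(2)] directed_fun_closed[OF c]
      by (auto simp: Aut_tree_simps compose_def restrict_def directed_aut_def c_def g(1) fun_eq_iff)
    then have "inv\<^bsub>?A\<^esub> g = directed_aut d c (inv_into UNIV s)"
      using g c directed_aut_in_tree_auts
      by (intro A.inv_equality) (auto simp: Aut_tree_simps(1))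
    then show ?thesis using c by (auto simp: directed_gens_def)
  qed
  moreover have "inv\<^bsub>mother_group d\<^esub> g = inv\<^bsub>?A\<^esub> g" if "g \<in> ?S" for g
    using that sub unfolding mother_group_def by (intro A.inv_subgroup_generated) auto
  moreover have "generate (mother_group d) ?S = carrier (mother_group d)"
  proof -
    have c: "carrier (mother_group d) = generate ?A ?S"
      unfolding mother_group_def carrier_subgroup_generated
      using mother_gens_subset[of d] by (simp add: Int_absorb1)
    have "subgroup (generate ?A ?S) ?A"
      by (rule A.generate_is_subgroup[OF mother_gens_subset])
    from A.generate_consistent[OF _ this, of ?S] sub c show ?thesis
      by (simp add: mother_group_def subgroup_generated_def Int_absorb1[OF mother_gens_subset])
  qed
  ultimately show ?thesis
    using finite_mother_gens sub unfolding finite_symmetric_gen_set_def by auto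
qed

end

theory Submission
  imports Defs "HOL-Analysis.Brouwer_Fixpoint"
begin

text \<open>The mother group on an alphabet with \<open>d > 2\<close> letters contains a copy of \<open>\<int>\<^sup>m\<close> for every
  \<open>m\<close>. A homomorphic injection of \<open>\<int>\<^sup>m\<close> into a finitely generated group is a coarse embedding,
  because only finitely many elements have word length below a given bound. So an efficient
  cover of the group at a large scale restricts to an efficient cover of a large cube of the
  lattice, which contradicts the Lebesgue covering theorem. This is the lemma
  \<open>no_asdim_le_if_free_abelian\<close>; the covering theorem enters through Kuhn's combinatorial lemma,
  the one behind Brouwer's fixed point theorem.

  The copies of \<open>\<int>\<^sup>m\<close> come from the branch structure of the group. Let \<open>\<rho>\<close> be the rooted
  automorphism of the three-cycle \<open>1 \<mapsto> 2 \<mapsto> d \<mapsto> 1\<close> and \<open>N\<close> its normal closure. With \<open>g\<close>, also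
  \<open>(g, 1, \<dots>, 1)\<close> and \<open>(1, g, 1, \<dots>, 1)\<close> belong to \<open>N\<close> (\<open>place_first_in_N\<close>,
  \<open>place_second_in_N\<close>). For \<open>g = \<rho>\<close> this is a commutator identity which needs three letters: two
  directed automorphisms overlap at the letter \<open>d\<close>, and conjugating one of them by \<open>\<rho>\<close> moves its
  directed coordinate away, so that a single rooted coordinate stays common to both. For
  conjugates of \<open>\<rho>\<close> it follows since every element of the group is the first section of another
  element of the group that fixes the first letter.

  Finally \<open>N\<close> contains an element \<open>\<theta>\<close> of infinite order: its first section \<open>\<sigma>\<close> reproduces itself
  in its cube, in the way an adding machine does. Powers of \<open>\<theta>\<close> placed at the pairwise incomparable
  vertices \<open>2, 12, 112, \<dots>\<close> commute and are independent, which gives \<open>\<int>\<^sup>m\<close> (\<open>abelian_add\<close>,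
  \<open>abelian_eq_iff\<close>).\<close>

section \<open>A lower bound for asymptotic dimension\<close>

text \<open>A coarse form of the Lebesgue covering theorem for a grid with \<open>n + 1\<close> coordinates. Suppose that
  there are \<open>n + 1\<close> uniformly bounded families which are disjoint at the scale \<open>C\<close>. The piece
  of colour \<open>i\<close> at a grid point is too small to reach both faces of a large cube in direction \<open>i\<close>, so
  it can be put on the low or on the high side. These choices form a Kuhn labelling. Kuhn's lemma
  finds a unit cell whose corners disagree in every coordinate, but at the colour of its base
  point all corners belong to one thickened piece and agree.\<close>

lemma no_asdim_le_if_coarse_grid:
  fixes f :: "(nat \<Rightarrow> nat) \<Rightarrow> 'a" and dst :: "'a \<Rightarrow> 'a \<Rightarrow> real"
  assumes M: "\<And>x. f x \<in> M"
    and bornologous: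
      "\<And>x y. (\<And>i. i \<le> n \<Longrightarrow> \<bar>int (x i) - int (y i)\<bar> \<le> 2) \<Longrightarrow> dst (f x) (f y) \<le> C"
    and proper: "\<And>D. \<exists>E. \<forall>x y. dst (f x) (f y) \<le> D \<longrightarrow> (\<forall>i\<le>n. \<bar>int (x i) - int (y i)\<bar> \<le> E)"
  shows "\<not> asdim_le M dst n"
proof
  assume "asdim_le M dst n"
  then obtain \<U> where cover: "M = (\<Union>i\<le>n. \<Union>(\<U> i))"
    and disj: "\<And>i. i \<le> n \<Longrightarrow> r_disjoint dst (max C 1) (\<U> i)"
    and bdd: "(SUP i\<in>{..n}. SUP U\<in>\<U> i. ediam dst U) < \<infinity>"
    unfolding asdim_le_def by (metis less_max_iff_disj zero_less_one)
  obtain D where D: "(SUP i\<in>{..n}. SUP U\<in>\<U> i. ediam dst U) \<le> ereal D"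
    using bdd by (cases "SUP i\<in>{..n}. SUP U\<in>\<U> i. ediam dst U") auto
  have diam: "dst a b \<le> D" if "i \<le> n" "U \<in> \<U> i" "a \<in> U" "b \<in> U" for i U a b
  proof -
    have "ereal (dst a b) \<le> ediam dst U"
      unfolding ediam_def using that by (meson SUP_upper2 order_refl)
    also have "\<dots> \<le> (SUP i\<in>{..n}. SUP U\<in>\<U> i. ediam dst U)"
      using that by (intro SUP_upper2[of i] SUP_upper) auto
    finally show ?thesis using D by (metis ereal_less_eq(3) order_trans)
  qed
  have same: "U = V" if "i \<le> n" "U \<in> \<U> i" "V \<in> \<U> i" "a \<in> U" "b \<in> V" "dst a b \<le> C" for i U V a b
  proof (rule ccontr)
    assume "U \<noteq> V"
    then have "ereal (max C 1) < (INF x\<in>U. INF y\<in>V. ereal (dst x y))"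
      using disj that unfolding r_disjoint_def by blast
    also have "\<dots> \<le> ereal (dst a b)"
      using that by (meson INF_lower2 order_refl)
    finally show False using that by simp
  qed
  obtain E where E: "\<And>x y i. dst (f x) (f y) \<le> D \<Longrightarrow> i \<le> n \<Longrightarrow> \<bar>int (x i) - int (y i)\<bar> \<le> E"
    using proper by meson
  \<comment> \<open>The side of the cube exceeds the diameter \<open>E\<close> of a piece thickened by one step at either end.\<close>
  define p where "p = nat \<bar>E\<bar> + 3"
  define near where "near x y \<longleftrightarrow> (\<forall>i\<le>n. \<bar>int (x i) - int (y i)\<bar> \<le> 1)" for x y :: "nat \<Rightarrow> nat"
  define thick where "thick U = {x. \<exists>z. near x z \<and> f z \<in> U}" for U
  \<comment> \<open>Points outside the thickened pieces of colour \<open>i\<close> are low only on the face itself. Inside, all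
    points of a thickened piece agree.\<close>
  define low where "low i x \<longleftrightarrow> x i = 0 \<or>
    (\<exists>U\<in>\<U> i. x \<in> thick U \<and> (\<exists>y\<in>thick U. y i = 0))" for i and x :: "nat \<Rightarrow> nat"
  define label where "label x i = (if low i x then 0 else 1 :: nat)" for x i
  have high: "\<not> low i x" if "i \<le> n" "x i = p" for i x
  proof
    assume "low i x"
    moreover have "x i \<noteq> 0" using that by (simp add: p_def)
    ultimately obtain U y where U: "U \<in> \<U> i" "x \<in> thick U" "y \<in> thick U" "y i = 0"
      unfolding low_def by auto
    then obtain z z' where z: "near x z" "near y z'" "f z \<in> U" "f z' \<in> U"
      unfolding thick_def by auto
    then have "\<bar>int (z i) - int (z' i)\<bar> \<le> E"
      using U that by (intro E diam) auto
    moreover have "\<bar>int (x i) - int (z i)\<bar> \<le> 1" "\<bar>int (y i) - int (z' i)\<bar> \<le> 1"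
      using z that unfolding near_def by auto
    ultimately show False using that U unfolding p_def by linarith
  qed
  have "0 < p" by (simp add: p_def)
  moreover have "\<forall>x. (\<forall>i<Suc n. x i \<le> p) \<longrightarrow> (\<forall>i<Suc n. label x i = 0 \<or> label x i = 1)"
    by (simp add: label_def)
  moreover have "\<forall>x. (\<forall>i<Suc n. x i \<le> p) \<longrightarrow> (\<forall>i<Suc n. x i = 0 \<longrightarrow> label x i = 0)"
    by (simp add: label_def low_def)
  moreover have "\<forall>x. (\<forall>i<Suc n. x i \<le> p) \<longrightarrow> (\<forall>i<Suc n. x i = p \<longrightarrow> label x i = 1)"
    by (simp add: label_def high less_Suc_eq_le)
  ultimately obtain q where q: "\<forall>i<Suc n. \<exists>r s. (\<forall>j<Suc n. q j \<le> r j \<and> r j \<le> q j + 1) \<and>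
      (\<forall>j<Suc n. q j \<le> s j \<and> s j \<le> q j + 1) \<and> label r i \<noteq> label s i"
    by (rule kuhn_lemma)
  obtain i U where iU: "i \<le> n" "U \<in> \<U> i" "f q \<in> U"
    using M[of q] cover by auto
  \<comment> \<open>The cell lies in the thickening of the piece \<open>U\<close> of its base point, and in no other one of
    colour \<open>i\<close>: its base point is within two steps of the pieces involved.\<close>
  have low_iff: "low i x \<longleftrightarrow> (\<exists>y\<in>thick U. y i = 0)"
    if "\<forall>j<Suc n. q j \<le> x j \<and> x j \<le> q j + 1" for x
  proof -
    have xq: "near x q"
      unfolding near_def
    proof (intro allI impI)
      fix j assume "j \<le> n"
      then have "q j \<le> x j \<and> x j \<le> q j + 1" using that by simp
      then show "\<bar>int (x j) - int (q j)\<bar> \<le> 1" by linarith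
    qed
    then have "x \<in> thick U" using iU unfolding thick_def by auto
    moreover have "V = U" if V: "V \<in> \<U> i" "x \<in> thick V" for V
    proof -
      obtain z where z: "near x z" "f z \<in> V" using V unfolding thick_def by auto
      have "dst (f z) (f q) \<le> C"
      proof (rule bornologous)
        fix j assume "j \<le> n"
        then have "\<bar>int (x j) - int (z j)\<bar> \<le> 1" "\<bar>int (x j) - int (q j)\<bar> \<le> 1"
          using z xq unfolding near_def by auto
        then show "\<bar>int (z j) - int (q j)\<bar> \<le> 2" by linarith
      qed
      then show ?thesis using same iU V z by blast
    qed
    ultimately show ?thesis unfolding low_def using iU by blast
  qed
  have "i < Suc n" using iU(1) by simp
  note q[THEN spec, THEN mp, OF this]
  then obtain r s where r: "\<forall>j<Suc n. q j \<le> r j \<and> r j \<le> q j + 1"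
      and s: "\<forall>j<Suc n. q j \<le> s j \<and> s j \<le> q j + 1" and diff: "label r i \<noteq> label s i"
    by (elim exE conjE)
  have "low i r \<longleftrightarrow> low i s"
    using low_iff[OF r] low_iff[OF s] by (rule trans[OF _ sym])
  then show False using diff by (simp only: label_def)
qed

lemma (in monoid) foldr_mult_append:
  assumes "set us \<subseteq> carrier G" "set vs \<subseteq> carrier G"
  shows "foldr (\<otimes>) (us @ vs) \<one> = foldr (\<otimes>) us \<one> \<otimes> foldr (\<otimes>) vs \<one>"
proof -
  have closed: "foldr (\<otimes>) ws \<one> \<in> carrier G" if "set ws \<subseteq> carrier G" for ws
    using that by (induction ws) auto
  show ?thesis
    using assms by (induction us) (auto simp: m_assoc closed)
qed

lemma (in group) generated_by_words:
  assumes S: "finite_symmetric_gen_set G S" and g: "g \<in> carrier G"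
  shows "\<exists>ws\<in>lists S. foldr (\<otimes>) ws \<one> = g"
proof -
  have sub: "S \<subseteq> carrier G" and sym: "\<And>s. s \<in> S \<Longrightarrow> inv s \<in> S"
    using S unfolding finite_symmetric_gen_set_def by auto
  have "g \<in> generate G S"
    using S g unfolding finite_symmetric_gen_set_def by simp
  then show ?thesis
  proof (induction rule: generate.induct)
    case one
    show ?case by (rule bexI[of _ "[]"]) auto
  next
    case (incl h)
    then show ?case using sub by (intro bexI[of _ "[h]"]) auto
  next
    case (inv h)
    then show ?case using sub sym[of h] by (intro bexI[of _ "[inv h]"]) auto
  next
    case (eng h1 h2)
    then obtain us vs where "us \<in> lists S" "vs \<in> lists S"
        "foldr (\<otimes>) us \<one> = h1" "foldr (\<otimes>) vs \<one> = h2" by auto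
    then show ?case
      using sub foldr_mult_append[of us vs] by (intro bexI[of _ "us @ vs"]) (auto simp del: foldr_append)
  qed
qed

lemma (in group) finite_word_ball:
  assumes S: "finite_symmetric_gen_set G S"
  shows "finite {g \<in> carrier G. word_length G S g \<le> N}"
proof (rule finite_surj)
  show "finite {ws. set ws \<subseteq> S \<and> length ws \<le> N}"
    using S by (intro finite_lists_length_le) (simp add: finite_symmetric_gen_set_def)
  show "{g \<in> carrier G. word_length G S g \<le> N} \<subseteq>
      (\<lambda>ws. foldr (\<otimes>) ws \<one>) ` {ws. set ws \<subseteq> S \<and> length ws \<le> N}"
  proof safe
    fix g assume g: "g \<in> carrier G" "word_length G S g \<le> N"
    let ?P = "\<lambda>n. \<exists>ws\<in>lists S. length ws = n \<and> foldr (\<otimes>) ws \<one> = g"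
    have "?P (word_length G S g)"
      unfolding word_length_def by (rule LeastI_ex) (use generated_by_words[OF S g(1)] in blast)
    then show "g \<in> (\<lambda>ws. foldr (\<otimes>) ws \<one>) ` {ws. set ws \<subseteq> S \<and> length ws \<le> N}"
      using g(2) by auto
  qed
qed

text \<open>The hypotheses on \<open>F\<close> make it an injective homomorphism on \<open>\<int>\<^sup>n\<^sup>+\<^sup>1\<close>, whose elements are functions
  read at the arguments up to \<open>n\<close>. By homogeneity the distance of two values depends on the
  difference of the arguments only. Small differences are finitely many, so their lengths are
  bounded; conversely a ball of the group is finite, so it bounds the coordinates of the
  differences.\<close>

lemma (in group) no_asdim_le_if_free_abelian:
  fixes F :: "(nat \<Rightarrow> int) \<Rightarrow> 'a"
  assumes S: "finite_symmetric_gen_set G S"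
    and F: "\<And>k. F k \<in> carrier G"
    and hom: "\<And>k l. F (\<lambda>i. k i + l i) = F k \<otimes> F l"
    and inj: "\<And>k l. F k = F l \<longleftrightarrow> (\<forall>i\<le>n. k i = l i)"
  shows "\<not> asdim_le (carrier G) (word_dist G S) n"
proof -
  have dist: "word_dist G S (F k) (F l) = real (word_length G S (F (\<lambda>i. k i - l i)))" for k l
  proof -
    have "F k = F (\<lambda>i. k i - l i) \<otimes> F l"
      unfolding hom[symmetric] by simp
    then have "F k \<otimes> inv (F l) = F (\<lambda>i. k i - l i)"
      using F by (simp add: inv_solve_right')
    then show ?thesis by (simp add: word_dist_def)
  qed
  define B where "B = F ` ({..n} \<rightarrow>\<^sub>E {-2..2})"
  have "finite B" unfolding B_def by (intro finite_imageI finite_PiE) auto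
  have B: "F k \<in> B" if "\<And>i. i \<le> n \<Longrightarrow> \<bar>k i\<bar> \<le> 2" for k
  proof -
    have "F k = F (restrict k {..n})" using inj by auto
    moreover have "restrict k {..n} \<in> {..n} \<rightarrow>\<^sub>E {-2..2}" 
      using that by (simp add: restrict_PiE_iff abs_le_iff minus_le_iff)
    ultimately show ?thesis unfolding B_def by blast
  qed
  show ?thesis
  proof (rule no_asdim_le_if_coarse_grid[where f = "\<lambda>x. F (\<lambda>i. int (x i))"
        and C = "real (Max (word_length G S ` B))"])
    fix x y :: "nat \<Rightarrow> nat"
    assume "\<And>i. i \<le> n \<Longrightarrow> \<bar>int (x i) - int (y i)\<bar> \<le> 2"
    then have "F (\<lambda>i. int (x i) - int (y i)) \<in> B" by (intro B) auto
    then show "word_dist G S (F (\<lambda>i. int (x i))) (F (\<lambda>i. int (y i))) \<le> real (Max (word_length G S ` B))"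
      unfolding dist using \<open>finite B\<close> by simp
  next
    fix D :: real
    define P where "P = {g \<in> carrier G. word_length G S g \<le> nat \<lfloor>D\<rfloor>}"
    \<comment> \<open>The \<open>SOME\<close> need not return \<open>k\<close> for \<open>g = F k\<close>, but it agrees with \<open>k\<close> up to \<open>n\<close> by injectivity.\<close>
    define coord where "coord g i = (SOME k. F k = g) i" for g i
    define E where "E = Max ((\<lambda>(g, i). \<bar>coord g i\<bar>) ` (P \<times> {..n}))"
    have fin: "finite ((\<lambda>(g, i). \<bar>coord g i\<bar>) ` (P \<times> {..n}))"
      unfolding P_def using finite_word_ball[OF S] by blast
    have coord: "coord (F k) i = k i" if "i \<le> n" for k i
      unfolding coord_def using someI[of "\<lambda>l. F l = F k" k] inj that by auto
    have "\<bar>k i\<bar> \<le> E" if "real (word_length G S (F k)) \<le> D" "i \<le> n" for k i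
    proof -
      have "word_length G S (F k) \<le> nat \<lfloor>D\<rfloor>" using that by (simp add: le_nat_floor)
      then have "F k \<in> P" using F by (simp add: P_def)
      then have "\<bar>coord (F k) i\<bar> \<in> (\<lambda>(g, i). \<bar>coord g i\<bar>) ` (P \<times> {..n})"
        using that by force
      then show ?thesis unfolding E_def using fin coord[OF that(2)] by (metis Max_ge)
    qed
    then show "\<exists>E. \<forall>x y. word_dist G S (F (\<lambda>i. int (x i))) (F (\<lambda>i. int (y i))) \<le> D \<longrightarrow>
        (\<forall>i\<le>n. \<bar>int (x i) - int (y i)\<bar> \<le> E)"
      unfolding dist by blast
  qed (rule F)
qed

section \<open>Sections of elements of the mother group\<close>

text \<open>The automorphism \<open>(1, \<dots>, 1, g, 1, \<dots>, 1)\<close> with \<open>g\<close> at the letter \<open>x\<close>.\<close>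

definition place :: "nat \<Rightarrow> nat \<Rightarrow> (nat list \<Rightarrow> nat list) \<Rightarrow> nat list \<Rightarrow> nat list" where
  "place d x g = wreath_aut d (\<lambda>y. if y = x then g else \<one>\<^bsub>Aut_tree d\<^esub>) id"

lemma place_simps [simp]:
  "place d x g [] = []"
  "y # u \<in> tree_words d \<Longrightarrow> place d x g (y # u) = y # (if y = x then g u else u)"
  by (auto simp: place_def wreath_aut_def Aut_tree_simps)

lemma place_extensional: "place d x g \<in> extensional (tree_words d)"
  by (simp add: place_def wreath_aut_def)

lemma directed_aut_simps [simp]:
  "directed_aut d b s [] = []"
  "x # u \<in> tree_words d \<Longrightarrow> directed_aut d b s (x # u) =
     s x # (if x = d then directed_aut d b s u else rooted_aut d (b x) u)"
  by (auto simp: directed_aut_def)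

lemma rooted_aut_comp:
  assumes "a permutes {1..d}" "w \<in> tree_words d"
  shows "rooted_aut d c (rooted_aut d a w) = rooted_aut d (c \<circ> a) w"
  using assms permutes_range[OF assms(1)] by (cases w) auto

lemma rooted_aut_id_apply [simp]: "w \<in> tree_words d \<Longrightarrow> rooted_aut d id w = w"
  by (simp add: rooted_aut_id Aut_tree_simps)

locale mother =
  fixes d :: nat and M (structure)
  assumes d: "2 < d" and M_def: "M = mother_group d"

sublocale mother \<subseteq> group M
  by (simp add: M_def group_mother_group)

context mother
begin

abbreviation W :: "nat list set" where "W \<equiv> tree_words d"

lemma mult_apply [simp]: "u \<in> W \<Longrightarrow> (g \<otimes> h) u = h (g u)"
  by (simp add: M_def mother_group_def Aut_tree_simps compose_def)

lemma one_apply [simp]: "u \<in> W \<Longrightarrow> \<one> u = u"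
  by (simp add: M_def mother_group_def Aut_tree_simps)

lemma mult_extensional [simp]: "g \<otimes> h \<in> extensional W"
  by (simp add: M_def mother_group_def Aut_tree_simps)

lemma carrier_subset: "carrier M \<subseteq> tree_auts d"
  unfolding M_def mother_group_def
  using group.carrier_subgroup_generated_subset[OF group_Aut_tree] by (simp add: Aut_tree_simps(1))

lemma closed [simp]: "g \<in> carrier M \<Longrightarrow> u \<in> W \<Longrightarrow> g u \<in> W"
  using carrier_subset tree_auts_closed by blast

lemma Nil_fixed [simp]: "g \<in> carrier M \<Longrightarrow> g [] = []"
  using carrier_subset by (auto simp: tree_auts_def)

lemma carrier_extensional: "g \<in> carrier M \<Longrightarrow> g \<in> extensional W"
  using carrier_subset by (auto simp: tree_auts_def)

lemma inv_apply [simp]: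
  assumes "g \<in> carrier M" "u \<in> W"
  shows "(inv g) (g u) = u" "g ((inv g) u) = u"
  using assms mult_apply[of u g "inv g"] mult_apply[of u "inv g" g] by auto

lemma rooted_in [simp]: "a permutes {1..d} \<Longrightarrow> rooted_aut d a \<in> carrier M"
  using mother_gens_generating[of d]
  unfolding M_def finite_symmetric_gen_set_def rooted_gens_def by blast

lemma directed_in [simp]: "wreath_data d b s \<Longrightarrow> directed_aut d b s \<in> carrier M"
  using mother_gens_generating[of d]
  unfolding M_def finite_symmetric_gen_set_def directed_gens_def by blast

lemma inv_section:
  assumes "h \<in> carrier M" "g \<in> carrier M" "x \<in> {1..d}"
    and "\<And>u. u \<in> W \<Longrightarrow> h (x # u) = x # g u" "u \<in> W"
  shows "(inv h) (x # u) = x # (inv g) u"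
proof -
  have "h (x # (inv g) u) = x # u" using assms by simp
  then show ?thesis using assms inv_apply(1)[of h "x # (inv g) u"] by simp
qed

text \<open>The sections at the letter 1 of the elements fixing that letter exhaust the group. A rooted
  automorphism occurs at coordinate 1 of a directed one; a directed automorphism is its own section
  at \<open>d\<close>, and the transposition of 1 and \<open>d\<close> carries it to coordinate 1.\<close>

lemma ex_section_first:
  assumes "g \<in> carrier M"
  shows "\<exists>h\<in>carrier M. \<forall>u\<in>W. h (1 # u) = 1 # g u"
proof -
  have lift: "\<exists>h\<in>carrier M. \<forall>u\<in>W. h (1 # u) = 1 # g u" if "g \<in> rooted_gens d \<union> directed_gens d" for g
    using that
  proof
    assume "g \<in> rooted_gens d"
    then obtain a where a: "a permutes {1..d}" "g = rooted_aut d a" by (auto simp: rooted_gens_def)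
    show ?thesis
      using a d by (intro bexI[of _ "directed_aut d (\<lambda>i. if i = 1 then a else id) id"])
        (auto simp: permutes_id intro!: directed_in)
  next
    assume "g \<in> directed_gens d"
    then obtain b s where g: "wreath_data d b s" "g = directed_aut d b s" by (auto simp: directed_gens_def)
    have t: "Transposition.transpose 1 d permutes {1..d}" using d by (intro permutes_swap_id) auto
    have "g (d # u) = d # g u" if "u \<in> W" for u
      using g d that permutes_pred(1)[of s d] by auto
    then show ?thesis
      using g d t by (intro bexI[of _ "rooted_aut d (Transposition.transpose 1 d) \<otimes> g \<otimes> rooted_aut d (Transposition.transpose 1 d)"]) auto
  qed
  have gens: "rooted_gens d \<union> directed_gens d \<subseteq> carrier M"
    and "generate M (rooted_gens d \<union> directed_gens d) = carrier M"
    using mother_gens_generating[of d] unfolding M_def finite_symmetric_gen_set_def by auto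
  then have "g \<in> generate M (rooted_gens d \<union> directed_gens d)" using assms by simp
  then show ?thesis
  proof (induction rule: generate.induct)
    case one
    show ?case using d by (intro bexI[of _ \<one>]) auto
  next
    case (incl h)
    then show ?case by (rule lift)
  next
    case (inv h)
    then obtain k where "k \<in> carrier M" "\<forall>u\<in>W. k (1 # u) = 1 # h u" using lift by blast
    then show ?case using inv d gens by (intro bexI[of _ "inv k"]) (auto intro!: inv_section)
  next
    case (eng h1 h2)
    then obtain k1 k2 where "k1 \<in> carrier M" "\<forall>u\<in>W. k1 (1 # u) = 1 # h1 u"
      "k2 \<in> carrier M" "\<forall>u\<in>W. k2 (1 # u) = 1 # h2 u" by blast
    moreover have "h1 \<in> carrier M" using eng generate_in_carrier[OF gens] by blast
    ultimately show ?case using d by (intro bexI[of _ "k1 \<otimes> k2"]) auto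
  qed
qed

lemma place_mult:
  assumes "g \<in> carrier M"
  shows "place d x (g \<otimes> h) = place d x g \<otimes> place d x h"
proof (rule extensionalityI)
  fix w assume "w \<in> W"
  then show "place d x (g \<otimes> h) w = (place d x g \<otimes> place d x h) w"
    using assms by (cases w) auto
qed (auto simp: place_extensional)

lemma place_one: "place d x \<one> = \<one>"
proof (rule extensionalityI)
  fix w assume "w \<in> W"
  then show "place d x \<one> w = \<one> w" by (cases w) auto
qed (auto simp: place_extensional carrier_extensional)

text \<open>Only the section of \<open>h\<close> at \<open>x\<close> matters, since \<open>h\<close> fixes \<open>x\<close> and so permutes the words that begin with
  another letter, on which \<open>place d x k\<close> is trivial.\<close>

lemma place_conj:
  assumes h: "h \<in> carrier M" and g: "g \<in> carrier M" and k: "k \<in> carrier M"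
    and x: "x \<in> {1..d}" and sec: "\<And>u. u \<in> W \<Longrightarrow> h (x # u) = x # g u"
  shows "place d x (g \<otimes> k \<otimes> inv g) = h \<otimes> place d x k \<otimes> inv h"
proof (rule extensionalityI)
  fix w assume w: "w \<in> W"
  have sec': "(inv h) (x # u) = x # (inv g) u" if "u \<in> W" for u
    using inv_section[OF h g x sec that] .
  show "place d x (g \<otimes> k \<otimes> inv g) w = (h \<otimes> place d x k \<otimes> inv h) w"
  proof (cases w)
    case (Cons y u)
    show ?thesis
    proof (cases "y = x")
      case True
      then show ?thesis using Cons w g k x sec sec' by simp
    next
      case False
      have "hd (h w) \<noteq> x"
      proof
        assume "hd (h w) = x"
        show False
        proof (cases "h w")
          case Nil
          then have "w = []" using inv_apply(1)[OF h w] h by simp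
          then show False using Cons by simp
        next
          case (Cons z v)
          then have "h w = x # v" "v \<in> W" using \<open>hd (h w) = x\<close> closed[OF h w] by auto
          then have "w = x # (inv g) v" using inv_apply(1)[OF h w] sec' by simp
          then show False using False \<open>w = y # u\<close> by simp
        qed
      qed
      then have "place d x k (h w) = h w" using closed[OF h w] by (cases "h w") auto
      then show ?thesis using w h False Cons by simp
    qed
  qed (use h in simp)
qed (auto simp: place_extensional)

section \<open>The normal closure of a three-cycle\<close>

text \<open>Besides being a three-cycle, \<open>cyc\<close> is the commutator of the two transpositions, which is what
  \<open>place_\<rho>_in_N\<close> relies on.\<close>

definition cyc :: "nat \<Rightarrow> nat" where "cyc = Transposition.transpose 1 2 \<circ> Transposition.transpose 2 d"

definition \<rho> :: "nat list \<Rightarrow> nat list" where "\<rho> = rooted_aut d cyc"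

definition N :: "(nat list \<Rightarrow> nat list) set" where
  "N = generate M {g \<otimes> \<rho> \<otimes> inv g | g. g \<in> carrier M}"

lemma swaps: "Transposition.transpose 1 2 permutes {1..d}" "Transposition.transpose 2 d permutes {1..d}"
  using d by (auto intro!: permutes_swap_id)

lemma cyc_permutes: "cyc permutes {1..d}"
  unfolding cyc_def using swaps by (intro permutes_compose)

lemma cyc_simps: "cyc (Suc 0) = 2" "cyc 2 = d" "cyc d = 1"
    "x \<noteq> Suc 0 \<Longrightarrow> x \<noteq> 2 \<Longrightarrow> x \<noteq> d \<Longrightarrow> cyc x = x"
  using d by (auto simp: cyc_def Transposition.transpose_def)

lemma cyc_cube: "cyc \<circ> cyc \<circ> cyc = id"
proof
  fix x show "(cyc \<circ> cyc \<circ> cyc) x = id x"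
    using d by (cases "x \<in> {1, 2, d}") (auto simp: cyc_simps)
qed

lemma \<rho>_in [simp]: "\<rho> \<in> carrier M"
  unfolding \<rho>_def by (rule rooted_in[OF cyc_permutes])

lemma \<rho>_simps [simp]: "x # u \<in> W \<Longrightarrow> \<rho> (x # u) = cyc x # u"
  by (simp add: \<rho>_def)

lemma inv_\<rho>: "inv \<rho> = \<rho> \<otimes> \<rho>"
proof -
  have "\<rho> \<otimes> \<rho> \<otimes> \<rho> = \<one>"
  proof (rule extensionalityI)
    fix w assume "w \<in> W"
    then show "(\<rho> \<otimes> \<rho> \<otimes> \<rho>) w = \<one> w"
      using permutes_range[OF cyc_permutes] fun_cong[OF cyc_cube] by (cases w) auto
  qed (auto simp: carrier_extensional)
  then show ?thesis by (intro inv_equality) auto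
qed

lemma conjugates_subset: "{g \<otimes> \<rho> \<otimes> inv g | g. g \<in> carrier M} \<subseteq> carrier M"
  by auto

lemma N_subgroup: "subgroup N M"
  unfolding N_def by (rule generate_is_subgroup[OF conjugates_subset])

lemma N_normal: "N \<lhd> M"
  unfolding N_def
proof (rule normal_generateI[OF conjugates_subset])
  fix h g assume "h \<in> {g \<otimes> \<rho> \<otimes> inv g | g. g \<in> carrier M}" and g: "g \<in> carrier M"
  then obtain k where k: "k \<in> carrier M" "h = k \<otimes> \<rho> \<otimes> inv k" by blast
  then have "g \<otimes> h \<otimes> inv g = (g \<otimes> k) \<otimes> \<rho> \<otimes> inv (g \<otimes> k)"
    using g by (simp add: m_assoc inv_mult_group)
  then show "g \<otimes> h \<otimes> inv g \<in> {g \<otimes> \<rho> \<otimes> inv g | g. g \<in> carrier M}"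
    using k g by blast
qed

lemma N_subset: "g \<in> N \<Longrightarrow> g \<in> carrier M"
  using N_subgroup by (rule subgroup.mem_carrier)

lemma N_mult: "g \<in> N \<Longrightarrow> h \<in> N \<Longrightarrow> g \<otimes> h \<in> N"
  using N_subgroup by (rule subgroup.m_closed)

lemma N_inv: "g \<in> N \<Longrightarrow> inv g \<in> N"
  using N_subgroup by (rule subgroup.m_inv_closed)

lemma N_conj: "h \<in> N \<Longrightarrow> g \<in> carrier M \<Longrightarrow> g \<otimes> h \<otimes> inv g \<in> N"
  using N_normal by (rule normal.inv_op_closed2)

lemma \<rho>_in_N: "\<rho> \<in> N"
proof -
  have "\<one> \<otimes> \<rho> \<otimes> inv \<one> \<in> N" unfolding N_def by (rule generate.incl) blast
  then show ?thesis by simp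
qed

lemma commutator_in_N: "h \<in> N \<Longrightarrow> g \<in> carrier M \<Longrightarrow> g \<otimes> h \<otimes> inv g \<otimes> inv h \<in> N"
  by (intro N_mult N_conj N_inv)

lemma involution_inv: "g \<in> carrier M \<Longrightarrow> g \<otimes> g = \<one> \<Longrightarrow> inv g = g"
  by (rule inv_equality)

text \<open>Let \<open>\<beta> = ((1 2), 1, \<dots>, 1, \<beta>)\<close> and \<open>\<gamma> = (1, (2 d), 1, \<dots>, 1, \<gamma>)\<close>, two commuting involutions. The
  conjugate \<open>\<delta> = \<rho> \<gamma> \<rho>\<^sup>-\<^sup>1 = ((2 d), \<gamma>, 1, \<dots>, 1)\<close> shares only the first coordinate with \<open>\<beta>\<close>, hence
  \<open>\<beta> \<delta> \<beta> \<delta> = (\<rho>, 1, \<dots>, 1)\<close>. This commutator lies in \<open>N\<close> since \<open>\<gamma>\<close> and \<open>\<delta>\<close> agree modulo \<open>N\<close>: with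
  \<open>n = \<gamma> \<delta> \<in> N\<close> it equals \<open>\<beta> n\<^sup>-\<^sup>1 \<beta>\<^sup>-\<^sup>1 n\<close>, as \<open>\<beta>\<close> commutes with \<open>\<gamma>\<close>.\<close>

lemma place_\<rho>_in_N: "place d 1 \<rho> \<in> N"
proof -
  define b where "b = (\<lambda>i :: nat. if i = 1 then Transposition.transpose 1 2 else (id :: nat \<Rightarrow> nat))"
  define c where "c = (\<lambda>i :: nat. if i = 2 then Transposition.transpose 2 d else (id :: nat \<Rightarrow> nat))"
  define \<beta> where "\<beta> = directed_aut d b id"
  define \<gamma> where "\<gamma> = directed_aut d c id"
  have b: "wreath_data d b id" and c: "wreath_data d c id"
    using swaps by (auto simp: b_def c_def permutes_id)
  have in_M: "\<beta> \<in> carrier M" "\<gamma> \<in> carrier M"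
    unfolding \<beta>_def \<gamma>_def using b c by (auto intro!: directed_in)
  have \<beta>2: "\<beta> (\<beta> w) = w" and \<gamma>2: "\<gamma> (\<gamma> w) = w" and comm: "\<beta> (\<gamma> w) = \<gamma> (\<beta> w)" if w: "w \<in> W" for w
  proof -
    have *: "\<beta> u = directed_fun d b id u" "\<gamma> u = directed_fun d c id u" if "u \<in> W" for u
      using that by (auto simp: \<beta>_def \<gamma>_def directed_aut_def)
    show "\<beta> (\<beta> w) = w"
      using directed_fun_mult[OF b b w] directed_fun_id[OF _ w] directed_fun_closed[OF b w] w
      by (simp add: * b_def)
    show "\<gamma> (\<gamma> w) = w"
      using directed_fun_mult[OF c c w] directed_fun_id[OF _ w] directed_fun_closed[OF c w] w
      by (simp add: * c_def)
    have "(\<lambda>i. b (id i) \<circ> c i) = (\<lambda>i. c (id i) \<circ> b i)" by (auto simp: b_def c_def)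
    then show "\<beta> (\<gamma> w) = \<gamma> (\<beta> w)"
      using directed_fun_mult[OF b c w] directed_fun_mult[OF c b w]
        directed_fun_closed[OF b w] directed_fun_closed[OF c w] w
      by (simp add: *)
  qed
  have inv: "inv \<beta> = \<beta>" "inv \<gamma> = \<gamma>"
    by (rule involution_inv, simp add: in_M,
        rule extensionalityI[where A = W], auto simp: in_M \<beta>2 \<gamma>2 carrier_extensional)+
  define n where "n = \<gamma> \<otimes> \<rho> \<otimes> inv \<gamma> \<otimes> inv \<rho>"
  have n: "n \<in> N" unfolding n_def using in_M by (intro commutator_in_N \<rho>_in_N)
  have inv_n: "inv n = \<rho> \<otimes> (\<gamma> \<otimes> (\<rho> \<otimes> (\<rho> \<otimes> \<gamma>)))"
  proof -
    have "inv n = \<rho> \<otimes> (\<gamma> \<otimes> (inv \<rho> \<otimes> \<gamma>))"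
      unfolding n_def using in_M by (simp add: inv_mult_group inv m_assoc)
    then show ?thesis using in_M by (simp add: inv_\<rho> m_assoc)
  qed
  have n_eq: "n = \<gamma> \<otimes> (\<rho> \<otimes> (\<gamma> \<otimes> (\<rho> \<otimes> \<rho>)))"
    unfolding n_def using in_M by (simp add: inv inv_\<rho> m_assoc)
  have cyc_eq: "cyc = Transposition.transpose 2 d \<circ> Transposition.transpose 1 2
      \<circ> Transposition.transpose 2 d \<circ> Transposition.transpose 1 2"
  proof
    fix x show "cyc x = (Transposition.transpose 2 d \<circ> Transposition.transpose 1 2
      \<circ> Transposition.transpose 2 d \<circ> Transposition.transpose 1 2) x"
      using d by (cases "x \<in> {1, 2, d}") (auto simp: cyc_simps)
  qed
  \<comment> \<open>The product \<open>\<beta> n\<^sup>-\<^sup>1 \<beta>\<^sup>-\<^sup>1 n\<close> written without inverses, so that it can be evaluated letter by letter.\<close>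
  have key: "place d 1 \<rho> =
      \<beta> \<otimes> (\<rho> \<otimes> (\<gamma> \<otimes> (\<rho> \<otimes> (\<rho> \<otimes> \<gamma>)))) \<otimes> \<beta> \<otimes> (\<gamma> \<otimes> (\<rho> \<otimes> (\<gamma> \<otimes> (\<rho> \<otimes> \<rho>))))"
    (is "_ = ?rhs")
  proof (rule extensionalityI)
    fix w assume w: "w \<in> W"
    have \<beta>_simps: "\<beta> (Suc 0 # u) = Suc 0 # rooted_aut d (Transposition.transpose 1 2) u" "\<beta> (2 # u) = 2 # u" "\<beta> (d # u) = d # \<beta> u"
        "x \<noteq> Suc 0 \<Longrightarrow> x \<noteq> d \<Longrightarrow> x \<in> {1..d} \<Longrightarrow> \<beta> (x # u) = x # u" if "u \<in> W" for x u
      using that d by (auto simp: \<beta>_def b_def)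
    have \<gamma>_simps: "\<gamma> (2 # u) = 2 # rooted_aut d (Transposition.transpose 2 d) u" "\<gamma> (Suc 0 # u) = Suc 0 # u" "\<gamma> (d # u) = d # \<gamma> u"
        "x \<noteq> 2 \<Longrightarrow> x \<noteq> d \<Longrightarrow> x \<in> {1..d} \<Longrightarrow> \<gamma> (x # u) = x # u" if "u \<in> W" for x u
      using that d by (auto simp: \<gamma>_def c_def)
    show "place d 1 \<rho> w = ?rhs w"
    proof (cases w)
      case Nil
      then show ?thesis using in_M by simp
    next
      case (Cons x u)
      then have u: "u \<in> W" and x: "x \<in> {1..d}" using w by auto
      have \<rho>_u: "\<rho> u = rooted_aut d (Transposition.transpose 2 d) (rooted_aut d (Transposition.transpose 1 2)
          (rooted_aut d (Transposition.transpose 2 d) (rooted_aut d (Transposition.transpose 1 2) u)))"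
        using u swaps cyc_eq by (simp add: \<rho>_def rooted_aut_comp rooted_aut_closed permutes_compose comp_assoc)
      have qq: "rooted_aut d (Transposition.transpose 2 d) (rooted_aut d (Transposition.transpose 2 d) v) = v"
        if "v \<in> W" for v
        using that swaps by (simp add: rooted_aut_comp)
      note facts = \<beta>_simps \<gamma>_simps cyc_simps rooted_aut_closed \<rho>_u qq \<beta>2 \<gamma>2 comm
      consider "x = Suc 0" | "x = 2" | "x = d" | "x \<noteq> Suc 0" "x \<noteq> 2" "x \<noteq> d" by blast
      then show ?thesis
        by cases (use Cons u x d in_M swaps in \<open>simp_all add: facts\<close>)
    qed
  qed (auto simp: place_extensional)
  have "\<beta> \<otimes> inv n \<otimes> inv \<beta> \<otimes> n \<in> N"
    using n in_M by (intro N_mult N_conj N_inv)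
  then show ?thesis unfolding key inv_n inv(1) by (simp only: n_eq[symmetric])
qed

text \<open>The map \<open>g \<mapsto> (g, 1, \<dots>, 1)\<close> is multiplicative, so it suffices to treat the conjugates of \<open>\<rho>\<close>. Their
  inverses are covered as well because \<open>\<rho>\<close> has order three, so that the inverse of \<open>\<rho>\<close> is its square.\<close>

lemma place_first_in_N:
  assumes "g \<in> N"
  shows "place d 1 g \<in> N"
proof -
  have conj: "place d 1 (g \<otimes> k \<otimes> inv g) \<in> N"
    if g: "g \<in> carrier M" and k: "k \<in> carrier M" "place d 1 k \<in> N" for g k
  proof -
    obtain h where "h \<in> carrier M" "\<forall>u\<in>W. h (1 # u) = 1 # g u" using ex_section_first[OF g] by blast
    then show ?thesis using place_conj[of h g k 1] g k d by (simp add: N_conj)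
  qed
  show ?thesis
    using assms unfolding N_def
  proof (induction rule: generate.induct)
    case one
    show ?case using N_subgroup unfolding N_def[symmetric] place_one by (rule subgroup.one_closed)
  next
    case (incl h)
    then show ?case using conj place_\<rho>_in_N unfolding N_def[symmetric] by auto
  next
    case (inv h)
    then obtain g where g: "g \<in> carrier M" "h = g \<otimes> \<rho> \<otimes> inv g" by blast
    then have "inv h = g \<otimes> (\<rho> \<otimes> \<rho>) \<otimes> inv g"
      by (simp add: inv_mult_group m_assoc flip: inv_\<rho>)
    moreover have "place d 1 (\<rho> \<otimes> \<rho>) \<in> N"
      using place_\<rho>_in_N by (simp add: place_mult N_mult)
    ultimately show ?case using conj g unfolding N_def[symmetric] by simp
  next
    case (eng h1 h2)
    then show ?case
      using N_subset by (simp add: place_mult N_mult flip: N_def)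
  qed
qed

lemma place_second_in_N:
  assumes "g \<in> N"
  shows "place d 2 g \<in> N"
proof -
  let ?\<tau> = "rooted_aut d (Transposition.transpose 1 2)"
  have \<tau>: "?\<tau> \<in> carrier M" by (rule rooted_in[OF swaps(1)])
  have "?\<tau> \<otimes> ?\<tau> = \<one>"
  proof (rule extensionalityI)
    fix w assume "w \<in> W"
    then show "(?\<tau> \<otimes> ?\<tau>) w = \<one> w"
      using swaps(1) by (simp add: rooted_aut_comp)
  qed (auto simp: carrier_extensional)
  then have inv: "inv ?\<tau> = ?\<tau>" using \<tau> by (rule involution_inv[rotated])
  have "place d 2 g = ?\<tau> \<otimes> place d 1 g \<otimes> inv ?\<tau>"
    unfolding inv
  proof (rule extensionalityI)
    fix w assume w: "w \<in> W"
    show "place d 2 g w = (?\<tau> \<otimes> place d 1 g \<otimes> ?\<tau>) w"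
    proof (cases w)
      case (Cons x u)
      consider "x = 1" | "x = 2" | "x \<noteq> 1" "x \<noteq> 2" by blast
      then show ?thesis
        by cases (use w Cons d N_subset[OF assms] in simp_all)
    qed simp
  qed (auto simp: place_extensional)
  then show ?thesis using place_first_in_N[OF assms] \<tau> by (simp add: N_conj)
qed

section \<open>An element of infinite order\<close>

lemma pow_section:
  assumes "h \<in> carrier M" "g \<in> carrier M" "x \<in> {1..d}"
    and sec: "\<And>u. u \<in> W \<Longrightarrow> h (x # u) = x # g u" and "u \<in> W"
  shows "(h [^] (m :: nat)) (x # u) = x # (g [^] m) u"
  using assms by (induction m) auto

text \<open>In wreath notation \<open>\<kappa> = (\<rho>, \<rho>, 1, \<dots>, 1, \<kappa>)\<close>. The two copies of \<open>\<rho>\<close> are chosen so that the sections met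
  along one turn of the cycle multiply to \<open>\<sigma>\<close> again, see \<open>\<sigma>_cube\<close>.\<close>

definition \<kappa> :: "nat list \<Rightarrow> nat list" where
  "\<kappa> = directed_aut d (\<lambda>i. if i \<le> 2 then cyc else id) id"

definition \<sigma> :: "nat list \<Rightarrow> nat list" where "\<sigma> = \<rho> \<otimes> inv \<kappa>"

text \<open>A commutator with \<open>\<rho>\<close>, hence an element of \<open>N\<close>, chosen so that its section at the letter 1 is \<open>\<sigma>\<close>.\<close>

definition \<theta> :: "nat list \<Rightarrow> nat list" where "\<theta> = \<kappa> \<otimes> inv \<rho> \<otimes> inv \<kappa> \<otimes> \<rho>"

lemma \<kappa>_in [simp]: "\<kappa> \<in> carrier M"
  unfolding \<kappa>_def using cyc_permutes by (intro directed_in) (auto simp: permutes_id)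

lemma \<sigma>_in [simp]: "\<sigma> \<in> carrier M"
  by (simp add: \<sigma>_def)

lemma \<theta>_in_N: "\<theta> \<in> N"
  unfolding \<theta>_def by (intro N_mult N_conj N_inv \<rho>_in_N \<kappa>_in)

lemma inv_\<kappa>_simps:
  assumes "u \<in> W"
  shows "(inv \<kappa>) (Suc 0 # u) = Suc 0 # (inv \<rho>) u"
    and "(inv \<kappa>) (2 # u) = 2 # (inv \<rho>) u"
    and "(inv \<kappa>) (d # u) = d # (inv \<kappa>) u"
proof -
  have "\<kappa> (Suc 0 # v) = Suc 0 # \<rho> v" "\<kappa> (2 # v) = 2 # \<rho> v" "\<kappa> (d # v) = d # \<kappa> v" if "v \<in> W" for v
    using that d by (auto simp: \<kappa>_def \<rho>_def)
  then show "(inv \<kappa>) (Suc 0 # u) = Suc 0 # (inv \<rho>) u"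
    and "(inv \<kappa>) (2 # u) = 2 # (inv \<rho>) u"
    and "(inv \<kappa>) (d # u) = d # (inv \<kappa>) u"
    using d assms by (auto intro!: inv_section)
qed

lemma \<sigma>_simps:
  assumes "u \<in> W"
  shows "\<sigma> (d # u) = Suc 0 # (inv \<rho>) u"
    and "\<sigma> (Suc 0 # u) = 2 # (inv \<rho>) u"
    and "\<sigma> (2 # u) = d # (inv \<kappa>) u"
  using assms d by (simp_all add: \<sigma>_def inv_\<kappa>_simps cyc_simps)

text \<open>The orbit of the first letter is \<open>d \<mapsto> 1 \<mapsto> 2 \<mapsto> d\<close>. On the way the rest of the word is changed by
  \<open>\<rho>\<^sup>-\<^sup>1\<close> twice and then by \<open>\<kappa>\<^sup>-\<^sup>1\<close>, and \<open>\<rho>\<^sup>-\<^sup>1 \<rho>\<^sup>-\<^sup>1 \<kappa>\<^sup>-\<^sup>1 = \<rho> \<kappa>\<^sup>-\<^sup>1 = \<sigma>\<close>.\<close>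

lemma \<sigma>_cube:
  assumes "u \<in> W"
  shows "(\<sigma> [^] (3 :: nat)) (d # u) = d # \<sigma> u"
proof -
  have "\<rho> \<otimes> \<rho> \<otimes> \<rho> = \<one>" using inv_\<rho> \<rho>_in l_inv by metis
  then have "inv \<rho> \<otimes> inv \<rho> = \<rho>" by (simp add: inv_\<rho> m_assoc)
  then have "(inv \<rho>) ((inv \<rho>) u) = \<rho> u" using assms by (metis mult_apply)
  then show ?thesis
    using assms d by (simp add: numeral_3_eq_3 \<sigma>_simps) (simp add: \<sigma>_def)
qed

text \<open>Infinite descent: a trivial power fixes the letter \<open>d\<close>, so its exponent is a multiple \<open>3 m\<close> of three,
  and then the power with exponent \<open>m\<close> is its section at \<open>d\<close>.\<close>

lemma \<sigma>_pow_eq_one: "\<sigma> [^] (k :: nat) = \<one> \<Longrightarrow> k = 0"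
proof (induction k rule: less_induct)
  case (less k)
  define m where "m = k div 3"
  have "\<sigma> [^] k = (\<sigma> [^] (3 :: nat)) [^] m \<otimes> \<sigma> [^] (k mod 3)"
    unfolding m_def by (simp add: nat_pow_pow nat_pow_mult)
  then have pow: "((\<sigma> [^] (3 :: nat)) [^] m \<otimes> \<sigma> [^] (k mod 3)) w = w" if "w \<in> W" for w
    using less.prems one_apply[OF that] by simp
  have cube: "((\<sigma> [^] (3 :: nat)) [^] m) (d # u) = d # (\<sigma> [^] m) u" if "u \<in> W" for u
    using d that \<sigma>_cube by (intro pow_section) auto
  have id: "(\<sigma> [^] (k mod 3)) (d # (\<sigma> [^] m) u) = d # u" if "u \<in> W" for u
    using pow[of "d # u"] that d by (simp add: cube)
  have "k mod 3 = 0"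
  proof (rule ccontr)
    assume "k mod 3 \<noteq> 0"
    then consider "k mod 3 = 1" | "k mod 3 = 2" by linarith
    then show False
      by cases (use id[of "[]"] d in \<open>simp_all add: \<sigma>_simps numeral_2_eq_2\<close>)
  qed
  then have "(\<sigma> [^] m) u = u" if "u \<in> W" for u
    using id[OF that] that d by simp
  then have "\<sigma> [^] m = \<one>"
    by (intro extensionalityI[where A = W]) (auto simp: carrier_extensional)
  then have "m = 0" if "k \<noteq> 0" using less.IH[of m] that unfolding m_def by simp
  then show "k = 0" using \<open>k mod 3 = 0\<close> unfolding m_def by (metis div_mod_decomp mult_0 add_0)
qed

lemma \<theta>_pow_eq_iff: "\<theta> [^] (k :: int) = \<theta> [^] l \<longleftrightarrow> k = l"
proof -
  have sec: "\<theta> (Suc 0 # u) = Suc 0 # \<sigma> u" if "u \<in> W" for u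
  proof -
    have "(inv \<rho>) (Suc 0 # v) = d # v" if "v \<in> W" for v
      using that d by (simp add: inv_\<rho> cyc_simps)
    moreover have "\<kappa> (Suc 0 # u) = Suc 0 # \<rho> u" using that d by (simp add: \<kappa>_def \<rho>_def)
    ultimately show ?thesis using that d by (simp add: \<theta>_def \<sigma>_def inv_\<kappa>_simps cyc_simps)
  qed
  have "k = 0" if k: "\<theta> [^] (k :: nat) = \<one>" for k
  proof (rule \<sigma>_pow_eq_one)
    have "(\<sigma> [^] k) u = u" if u: "u \<in> W" for u
      using pow_section[of \<theta> \<sigma> "Suc 0" u k] sec u d k N_subset[OF \<theta>_in_N] by simp
    then show "\<sigma> [^] k = \<one>"
      by (intro extensionalityI[where A = W]) (auto simp: carrier_extensional)
  qed
  then have "ord \<theta> = 0" using N_subset[OF \<theta>_in_N] by (auto simp: ord_eq_0)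
  then show ?thesis using int_pow_eq[OF N_subset[OF \<theta>_in_N], of k l] by auto
qed

lemma \<theta>_pow_in_N: "\<theta> [^] (k :: int) \<in> N"
  using \<theta>_in_N N_subgroup by (rule subgroup_int_pow_closed[rotated])

section \<open>Free abelian subgroups of arbitrary rank\<close>

text \<open>The product of the elements \<open>\<theta> [^] k i\<close> for \<open>i < m\<close>, placed at the vertices \<open>1\<^sup>i 2\<close>. The recursion along
  the first letter replaces an argument about commuting factors by the multiplicativity of
  \<open>place\<close>.\<close>

primrec abelian :: "nat \<Rightarrow> (nat \<Rightarrow> int) \<Rightarrow> nat list \<Rightarrow> nat list" where
  "abelian 0 k = \<one>"
| "abelian (Suc m) k = place d 1 (abelian m (\<lambda>i. k (Suc i))) \<otimes> place d 2 (\<theta> [^] k 0)"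

lemma abelian_in_N: "abelian m k \<in> N"
proof (induction m arbitrary: k)
  case 0
  show ?case using subgroup.one_closed[OF N_subgroup] by simp
next
  case (Suc m)
  then show ?case using place_first_in_N place_second_in_N \<theta>_pow_in_N by (simp add: N_mult del: One_nat_def)
qed

lemma abelian_in [simp]: "abelian m k \<in> carrier M"
  by (rule N_subset[OF abelian_in_N])

lemma \<theta>_pow_in [simp]: "\<theta> [^] (k :: int) \<in> carrier M"
  by (rule N_subset[OF \<theta>_pow_in_N])

lemma abelian_Suc_apply:
  assumes "x # u \<in> W"
  shows "abelian (Suc m) k (x # u) =
    x # (if x = 1 then abelian m (\<lambda>i. k (Suc i)) u else if x = 2 then (\<theta> [^] k 0) u else u)"
  using assms by simp

lemma abelian_add: "abelian m (\<lambda>i. k i + l i) = abelian m k \<otimes> abelian m l"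
proof (induction m arbitrary: k l)
  case (Suc m)
  show ?case
  proof (rule extensionalityI)
    fix w assume w: "w \<in> W"
    show "abelian (Suc m) (\<lambda>i. k i + l i) w = (abelian (Suc m) k \<otimes> abelian (Suc m) l) w"
    proof (cases w)
      case (Cons x u)
      then show ?thesis
        using w d N_subset[OF \<theta>_in_N]
        by (simp add: abelian_Suc_apply Suc.IH int_pow_mult del: abelian.simps)
    qed (use Nil_fixed[OF abelian_in] in \<open>simp del: abelian.simps\<close>)
  qed (auto simp: carrier_extensional)
qed simp

lemma abelian_eq_iff: "abelian m k = abelian m l \<longleftrightarrow> (\<forall>i<m. k i = l i)"
proof (induction m arbitrary: k l)
  case (Suc m)
  let ?k = "\<lambda>i. k (Suc i)" and ?l = "\<lambda>i. l (Suc i)"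
  have "abelian (Suc m) k = abelian (Suc m) l \<longleftrightarrow>
      abelian m ?k = abelian m ?l \<and> \<theta> [^] k 0 = \<theta> [^] l 0"
  proof
    assume eq: "abelian (Suc m) k = abelian (Suc m) l"
    have "abelian m ?k u = abelian m ?l u \<and> (\<theta> [^] k 0) u = (\<theta> [^] l 0) u" if "u \<in> W" for u
      using fun_cong[OF eq, of "1 # u"] fun_cong[OF eq, of "2 # u"] that d
      by (simp add: abelian_Suc_apply del: abelian.simps)
    then show "abelian m ?k = abelian m ?l \<and> \<theta> [^] k 0 = \<theta> [^] l 0"
      by (auto intro!: extensionalityI[where A = W] simp: carrier_extensional)
  qed simp
  then show ?case
    by (auto simp: Suc.IH \<theta>_pow_eq_iff less_Suc_eq_0_disj simp del: abelian.simps)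
qed simp

end

theorem theorem1:
  fixes d :: nat and S :: "(nat list \<Rightarrow> nat list) set"
  assumes "d > 2"
    and "finite_symmetric_gen_set (mother_group d) S"
  shows "asdim (carrier (mother_group d)) (word_dist (mother_group d) S) = \<infinity>"
proof -
  interpret mother d "mother_group d" by unfold_locales (use assms in auto)
  have "\<not> asdim_le (carrier (mother_group d)) (word_dist (mother_group d) S) n" for n
    using assms(2) abelian_in abelian_add
    by (rule no_asdim_le_if_free_abelian[where F = "abelian (Suc n)"])
      (simp only: abelian_eq_iff less_Suc_eq_le)
  then show ?thesis by (simp add: asdim_infinite_iff)
qed

end
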